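(* For an integer $n\ge 2$, let $X_n$ be the orientable map with two vertices $u$ and $v$ and $n$ edges $e_1,\dots,e_n$, each joining $u$ and $v$, whose rotation system (clockwise cyclic order of edges around each vertex) is $(e_1,e_2,\dots,e_n)$ at $u$ and $(e_1,e_2,\dots,e_n)$ at $v$. Then in the vertex-face walk on $X_n$ there is perfect state transfer from $u$ to $v$ at time $1$, i.e. $U\hat Ne_u=\hat Ne_v$.
   Context: An orientable map is a 2-cell embedding of a connected multigraph in a closed orientable surface; it is determined up to homeomorphism by its rotation system. Each edge gives rise to two arcs on opposite sides of it, pointing in opposite directions; each arc lies in a face and is oriented along the clockwise facial walk of that face. Let $\mathcal A$ be the set of arcs, $v(a)$ the tail vertex and $f(a)$ the face of arc $a$. Let $N\in\{0,1\}^{\mathcal A\times V}$ with $N(a,w)=1$ iff $w=v(a)$, $M\in\{0,1\}^{\mathcal A\times F}$ with $M(a,f)=1$ iff $f=f(a)$, $D=N^TN$, $\Delta=M^TM$, $\hat N=ND^{-1/2}$, $\hat M=M\Delta^{-1/2}$, $Q=\hat N\hat N^T$, $P=\hat M\hat M^T$, $U=(2P-I)(2Q-I)$. $e_w$ denotes the standard basis vector of $\mathbb{C}^V$ indexed by $w$. *)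

theory Defs
  imports "Graph_Theory.Graph_Theory" "HOL-Combinatorics.Cycles" "HOL-Combinatorics.Orbits" "Jordan_Normal_Form.Matrix"
begin

section \<open>Orientable maps as rotation systems\<close>

text \<open>
  The arcs of \<open>map_graph\<close> are the arcs of the map: every edge contributes two arcs, which
  \<open>map_rev\<close> exchanges.  An arc stands for its edge as seen from its tail, so the clockwise cyclic
  order of the edges around \<open>w\<close> is a cyclic permutation of the arcs with tail \<open>w\<close>; \<open>map_rot\<close>
  collects these permutations.
\<close>

record ('v, 'a) rot_map =
  map_graph :: "('v, 'a) pre_digraph"
  map_rev :: "'a \<Rightarrow> 'a"
  map_rot :: "'a \<Rightarrow> 'a"

locale orientable_map =
  bidirected_digraph "map_graph X" "map_rev X" + fin_digraph "map_graph X"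
  for X :: "('v, 'a) rot_map" +
  assumes connected_map: "connected (map_graph X)"
    and rot_permutes: "map_rot X permutes arcs (map_graph X)"
    and rot_cyclic: "\<And>w. w \<in> verts (map_graph X) \<Longrightarrow> out_arcs (map_graph X) w \<noteq> {} \<Longrightarrow>
      cyclic_on (map_rot X) (out_arcs (map_graph X) w)"

text \<open>
  The face of an arc lies on its right, since facial walks are clockwise.  Arriving at the head of
  \<open>a\<close>, the walk leaves along the edge that precedes the edge of \<open>a\<close> in the clockwise order around
  that vertex.  A face is identified with the set of arcs of its facial walk.
\<close>

definition face_step :: "('v, 'a) rot_map \<Rightarrow> 'a \<Rightarrow> 'a" where
  "face_step X = inv_into UNIV (map_rot X) \<circ> map_rev X"

definition face_of :: "('v, 'a) rot_map \<Rightarrow> 'a \<Rightarrow> 'a set" where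
  "face_of X a = orbit (face_step X) a"

definition faces :: "('v, 'a) rot_map \<Rightarrow> 'a set set" where
  "faces X = face_of X ` arcs (map_graph X)"


section \<open>The vertex-face walk\<close>

text \<open>
  A matrix whose rows and columns are indexed by finite sets is represented with respect to lists
  enumerating these sets without repetition: \<open>as\<close> the arcs, \<open>vs\<close> the vertices, \<open>fs\<close> the faces.
\<close>

definition incidence_mat :: "('a \<Rightarrow> 'b) \<Rightarrow> 'a list \<Rightarrow> 'b list \<Rightarrow> complex mat" where
  "incidence_mat f xs ys =
     mat (length xs) (length ys) (\<lambda>(i, j). if ys ! j = f (xs ! i) then 1 else 0)"

definition basis_vec :: "'b list \<Rightarrow> 'b \<Rightarrow> complex vec" where
  "basis_vec ys w = vec (length ys) (\<lambda>j. if ys ! j = w then 1 else 0)"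

text \<open>\<open>diag_inv_sqrt D\<close> is the power $D^{-1/2}$ of a diagonal matrix with positive diagonal.\<close>

definition diag_inv_sqrt :: "complex mat \<Rightarrow> complex mat" where
  "diag_inv_sqrt D = mat_diag (dim_row D) (\<lambda>i. 1 / csqrt (D $$ (i, i)))"

definition normalized_mat :: "complex mat \<Rightarrow> complex mat" where
  "normalized_mat B = B * diag_inv_sqrt (transpose_mat B * B)"

definition N_mat :: "('v, 'a) rot_map \<Rightarrow> 'a list \<Rightarrow> 'v list \<Rightarrow> complex mat" where
  "N_mat X as vs = incidence_mat (tail (map_graph X)) as vs"

definition M_mat :: "('v, 'a) rot_map \<Rightarrow> 'a list \<Rightarrow> 'a set list \<Rightarrow> complex mat" where
  "M_mat X as fs = incidence_mat (face_of X) as fs"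

definition N_hat :: "('v, 'a) rot_map \<Rightarrow> 'a list \<Rightarrow> 'v list \<Rightarrow> complex mat" where
  "N_hat X as vs = normalized_mat (N_mat X as vs)"

definition M_hat :: "('v, 'a) rot_map \<Rightarrow> 'a list \<Rightarrow> 'a set list \<Rightarrow> complex mat" where
  "M_hat X as fs = normalized_mat (M_mat X as fs)"

definition Q_mat :: "('v, 'a) rot_map \<Rightarrow> 'a list \<Rightarrow> 'v list \<Rightarrow> complex mat" where
  "Q_mat X as vs = N_hat X as vs * transpose_mat (N_hat X as vs)"

definition P_mat :: "('v, 'a) rot_map \<Rightarrow> 'a list \<Rightarrow> 'a set list \<Rightarrow> complex mat" where
  "P_mat X as fs = M_hat X as fs * transpose_mat (M_hat X as fs)"

definition vertex_face_walk ::
    "('v, 'a) rot_map \<Rightarrow> 'a list \<Rightarrow> 'v list \<Rightarrow> 'a set list \<Rightarrow> complex mat" where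
  "vertex_face_walk X as vs fs =
     (2 \<cdot>\<^sub>m P_mat X as fs - 1\<^sub>m (length as)) * (2 \<cdot>\<^sub>m Q_mat X as vs - 1\<^sub>m (length as))"

text \<open>
  \<open>incidence_gram\<close> and \<open>diag_inv_sqrt_gram\<close> confirm that $D = N^T N$ and $\Delta = M^T M$ are
  diagonal and that \<open>diag_inv_sqrt\<close> gives the square roots of their inverses.
\<close>

lemma incidence_gram:
  assumes "distinct xs" "distinct ys"
  shows "transpose_mat (incidence_mat f xs ys) * incidence_mat f xs ys =
    mat_diag (length ys) (\<lambda>j. of_nat (card {x \<in> set xs. f x = ys ! j}))"
proof (rule eq_matI)
  fix j k
  assume "j < dim_row (mat_diag (length ys) (\<lambda>j. of_nat (card {x \<in> set xs. f x = ys ! j})) :: complex mat)"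
    and "k < dim_col (mat_diag (length ys) (\<lambda>j. of_nat (card {x \<in> set xs. f x = ys ! j})) :: complex mat)"
  then have j: "j < length ys" and k: "k < length ys" by (simp_all add: mat_diag_def)
  have "(transpose_mat (incidence_mat f xs ys) * incidence_mat f xs ys) $$ (j, k) =
      (\<Sum>i<length xs. (if ys ! j = f (xs ! i) then 1 else 0) * (if ys ! k = f (xs ! i) then 1 else (0::complex)))"
    using j k by (simp add: incidence_mat_def scalar_prod_def atLeast0LessThan)
  also have "\<dots> = (\<Sum>i<length xs. if j = k \<and> f (xs ! i) = ys ! j then 1 else 0)"
    using j k nth_eq_iff_index_eq[OF assms(2) j k] by (intro sum.cong refl) auto
  also have "\<dots> = (\<Sum>x\<in>set xs. if j = k \<and> f x = ys ! j then 1 else 0)"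
    using assms(1) by (intro sum.reindex_bij_betw bij_betw_nth) auto
  also have "\<dots> = (if j = k then of_nat (card {x \<in> set xs. f x = ys ! j}) else 0)"
    by (simp add: sum.If_cases Int_def)
  finally show "(transpose_mat (incidence_mat f xs ys) * incidence_mat f xs ys) $$ (j, k) =
    mat_diag (length ys) (\<lambda>j. of_nat (card {x \<in> set xs. f x = ys ! j})) $$ (j, k)"
    using j k by (simp add: mat_diag_def)
qed (auto simp: incidence_mat_def mat_diag_def)

lemma diag_inv_sqrt_gram:
  assumes "distinct xs" "distinct ys" "set ys = f ` set xs"
  defines "D \<equiv> transpose_mat (incidence_mat f xs ys) * incidence_mat f xs ys"
  shows "diag_inv_sqrt D * diag_inv_sqrt D * D = 1\<^sub>m (length ys)"
proof -
  define c :: "nat \<Rightarrow> complex" where "c j = of_nat (card {x \<in> set xs. f x = ys ! j})" for j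
  have D: "D = mat_diag (length ys) c"
    unfolding D_def c_def by (rule incidence_gram[OF assms(1,2)])
  have nz: "c j \<noteq> 0" if "j < length ys" for j
  proof -
    have "ys ! j \<in> f ` set xs" using that assms(3) nth_mem by blast
    then show ?thesis by (auto simp: c_def)
  qed
  have S: "diag_inv_sqrt D = mat_diag (length ys) (\<lambda>j. 1 / csqrt (c j))"
    by (rule eq_matI) (auto simp: diag_inv_sqrt_def D mat_diag_def)
  have sq: "csqrt z * csqrt z = z" for z
    using power2_csqrt[of z] by (simp add: power2_eq_square)
  show ?thesis
    unfolding S unfolding D
    unfolding mat_diag_diag
    by (rule eq_matI) (auto simp: mat_diag_def sq nz)
qed


section \<open>The dipole maps\<close>

datatype pole = Pole_u | Pole_v

fun other_pole :: "pole \<Rightarrow> pole" where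
  "other_pole Pole_u = Pole_v"
| "other_pole Pole_v = Pole_u"

text \<open>The edges are $e_1, \ldots, e_n$, and \<open>(i, w)\<close> is the arc of $e_i$ with tail \<open>w\<close>.\<close>

definition dipole_graph :: "nat \<Rightarrow> (pole, nat \<times> pole) pre_digraph" where
  "dipole_graph n = \<lparr>verts = {Pole_u, Pole_v}, arcs = {1..n} \<times> {Pole_u, Pole_v},
     tail = snd, head = other_pole \<circ> snd\<rparr>"

definition dipole_map :: "nat \<Rightarrow> (pole, nat \<times> pole) rot_map" where
  "dipole_map n = \<lparr>map_graph = dipole_graph n,
     map_rev = (\<lambda>(i, w). if (i, w) \<in> arcs (dipole_graph n) then (i, other_pole w) else (i, w)),
     map_rot = cycle_of_list (map (\<lambda>i. (i, Pole_u)) [1..<n + 1]) \<circ>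
               cycle_of_list (map (\<lambda>i. (i, Pole_v)) [1..<n + 1])\<rparr>"

lemma dipole_rot:
  assumes "i \<in> {1..n}"
  shows "map_rot (dipole_map n) (i, w) = (if i = n then 1 else i + 1, w)"
proof -
  define cs where "cs p = map (\<lambda>i. (i, p)) [1..<n + 1]" for p :: pole
  have dist: "distinct (cs p)" for p
    by (auto simp: cs_def distinct_map inj_on_def)
  have rot: "map (cycle_of_list (cs p)) (cs p) = rotate1 (cs p)" for p
    using cyclic_rotation[OF dist, of 1] by simp
  have nth: "cs p ! k = (k + 1, p)" if "k < n" for k p
    using that by (simp add: cs_def nth_append del: upt_Suc)
  have len: "length (cs p) = n" for p by (simp add: cs_def)
  have step: "cycle_of_list (cs p) (i, p) = (if i = n then 1 else i + 1, p)" for p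
  proof -
    have "cycle_of_list (cs p) (i, p) = cycle_of_list (cs p) (cs p ! (i - 1))"
      using assms by (subst nth) auto
    also have "\<dots> = map (cycle_of_list (cs p)) (cs p) ! (i - 1)"
      using assms len[of p] by (subst nth_map) auto
    also have "\<dots> = cs p ! (Suc (i - 1) mod n)"
      using assms by (subst rot, subst nth_rotate1) (auto simp: len)
    also have "\<dots> = (if i = n then 1 else i + 1, p)"
      using assms by (subst nth) auto
    finally show ?thesis .
  qed
  have out: "cycle_of_list (cs p) (j, q) = (j, q)" if "p \<noteq> q" for p q j
    using that by (intro id_outside_supp) (auto simp: cs_def)
  have "map_rot (dipole_map n) (i, w) = cycle_of_list (cs Pole_u) (cycle_of_list (cs Pole_v) (i, w))"
    by (simp add: dipole_map_def cs_def)
  then show ?thesis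
    by (cases w) (simp_all add: step out)
qed

lemma other_pole_neq: "other_pole w \<noteq> w" "w \<noteq> other_pole w" "other_pole (other_pole w) = w"
  by (cases w; simp)+

lemma orientable_dipole_map:
  assumes "n \<ge> 1"
  shows "orientable_map (dipole_map n)"
proof -
  let ?G = "map_graph (dipole_map n)"
  have G: "?G = dipole_graph n" by (simp add: dipole_map_def)
  have pole: "w = Pole_u \<or> w = Pole_v" for w by (cases w) auto
  have arcs: "arcs ?G = {1..n} \<times> UNIV" and verts: "verts ?G = UNIV"
    using pole by (auto simp: G dipole_graph_def)
  have tail: "tail ?G = snd" and head: "head ?G = other_pole \<circ> snd"
    by (simp_all add: G dipole_graph_def)
  have rev: "map_rev (dipole_map n) (i, w) = (if i \<in> {1..n} then (i, other_pole w) else (i, w))" for i w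
    using pole by (auto simp: dipole_map_def dipole_graph_def)
  have fin: "finite (UNIV :: pole set)"
    using pole by (intro finite_subset[of UNIV "{Pole_u, Pole_v}"]) auto
  show ?thesis
  proof
    show "connected ?G"
    proof -
      have adj: "(w, other_pole w) \<in> arcs_ends (mk_symmetric ?G)" for w
      proof -
        have "(1, w) \<in> arcs ?G" using assms by (simp add: arcs)
        then have "(w, other_pole w) \<in> arcs_ends ?G"
          by (force simp: arcs_ends_conv tail head)
        then show ?thesis by (auto simp: mk_symmetric_def arcs_ends_conv)
      qed
      have "(x, y) \<in> rtrancl_on UNIV (arcs_ends (mk_symmetric ?G))" for x y
      proof (cases "y = x")
        case False
        then have "y = other_pole x" by (cases x; cases y) auto
        then show ?thesis using adj[of x] by (auto intro: rtrancl_on_into_rtrancl_on)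
      qed auto
      then show ?thesis
        by (simp add: connected_def strongly_connected_def reachable_def verts)
    qed
    show "map_rot (dipole_map n) permutes arcs ?G"
    proof -
      have "cycle_of_list (map (\<lambda>i. (i, p)) [1..<n + 1]) permutes arcs ?G" for p
        by (rule permutes_subset[OF cycle_permutes]) (auto simp: arcs)
      then show ?thesis
        by (simp add: dipole_map_def permutes_compose)
    qed
    show "cyclic_on (map_rot (dipole_map n)) (out_arcs ?G w)" for w
    proof -
      have out: "out_arcs ?G w = (\<lambda>i. (i, w)) ` {1..n}"
        by (auto simp: out_arcs_def arcs tail)
      have pow: "((map_rot (dipole_map n)) ^^ k) (1, w) = (k + 1, w)" if "k < n" for k
        using that by (induction k) (auto simp: dipole_rot)
      have "((map_rot (dipole_map n)) ^^ n) (1, w) = (map_rot (dipole_map n)) (((map_rot (dipole_map n)) ^^ (n - 1)) (1, w))"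
        using assms by (cases n) auto
      also have "\<dots> = (1, w)"
        using assms by (subst pow) (auto simp: dipole_rot)
      finally have cyc: "((map_rot (dipole_map n)) ^^ n) (1, w) = (1, w)" .
      have "orbit (map_rot (dipole_map n)) (1, w) = out_arcs ?G w"
      proof
        show "orbit (map_rot (dipole_map n)) (1, w) \<subseteq> out_arcs ?G w"
        proof
          fix a assume "a \<in> orbit (map_rot (dipole_map n)) (1, w)"
          then show "a \<in> out_arcs ?G w"
            using assms unfolding out by induction (auto simp: dipole_rot)
        qed
        show "out_arcs ?G w \<subseteq> orbit (map_rot (dipole_map n)) (1, w)"
        proof
          fix a assume "a \<in> out_arcs ?G w"
          then obtain i where i: "a = (i, w)" "1 \<le> i" "i \<le> n" by (auto simp: out)
          then have "a = ((map_rot (dipole_map n)) ^^ (if i = 1 then n else i - 1)) (1, w)"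
            using cyc pow[of "i - 1"] by auto
          then show "a \<in> orbit (map_rot (dipole_map n)) (1, w)"
            unfolding orbit_altdef using i by (auto intro!: exI[of _ "if i = 1 then n else i - 1"])
        qed
      qed
      moreover have "(1, w) \<in> out_arcs ?G w" using assms by (auto simp: out)
      ultimately show ?thesis unfolding cyclic_on_def by metis
    qed
  qed (auto simp: arcs verts tail head rev fin other_pole_neq split: if_splits)
qed

end

theory Submission
  imports Defs
begin

text \<open>
  \<open>Q\<close> and \<open>P\<close> average a function on the arcs over the arcs with the same tail and over the arcs of
  the same face.  Up to the factor \<open>1 / sqrt n\<close>, the initial state is the indicator function of the
  arcs leaving \<open>u\<close>, which \<open>Q\<close> fixes.  A step along a facial walk exchanges the arcs leaving \<open>u\<close>
  with the arcs leaving \<open>v\<close>, so each face contains equally many of both and \<open>P\<close> sends this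
  indicator function to the constant \<open>1 / 2\<close>.  Hence \<open>2 P - I\<close> turns it into the indicator
  function of the arcs leaving \<open>v\<close>.
\<close>

section \<open>Averaging over the fibres of a function\<close>

lemma smult_mat_mult_vec:
  assumes "dim_vec v = dim_col A"
  shows "(c \<cdot>\<^sub>m A) *\<^sub>v v = c \<cdot>\<^sub>v (A *\<^sub>v (v :: 'a :: comm_ring_1 vec))"
  by (rule eq_vecI) (use assms in \<open>simp_all add: scalar_prod_def sum_distrib_left mult.assoc\<close>)

lemma csqrt_mult_self: "csqrt z * csqrt z = z"
  using power2_csqrt[of z] by (simp add: power2_eq_square)

text \<open>The Gram matrix is diagonal with the fibre sizes of \<open>f\<close>, so normalizing
  rescales columns. A nonzero entry of row \<open>i\<close> lies in the column of
  \<open>f (xs ! i)\<close>, so its scale can be read off the row. An empty fibre gets the default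
  \<open>1 / csqrt 0 = 0\<close>, and its column is zero anyway.\<close>

lemma normalized_incidence_mat:
  assumes "distinct xs" "distinct ys"
  shows "normalized_mat (incidence_mat f xs ys) =
    mat (length xs) (length ys) (\<lambda>(i, j). if ys ! j = f (xs ! i)
      then 1 / csqrt (of_nat (card {x \<in> set xs. f x = f (xs ! i)})) else 0)"
proof -
  have B: "incidence_mat f xs ys \<in> carrier_mat (length xs) (length ys)"
    by (simp add: incidence_mat_def)
  have D: "diag_inv_sqrt (transpose_mat (incidence_mat f xs ys) * incidence_mat f xs ys) =
      mat_diag (length ys) (\<lambda>j. 1 / csqrt (of_nat (card {x \<in> set xs. f x = ys ! j})))"
    unfolding incidence_gram[OF assms] diag_inv_sqrt_def
    by (rule eq_matI) (auto simp: mat_diag_def)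
  show ?thesis
    unfolding normalized_mat_def D mat_diag_mult_right[OF B]
    by (rule eq_matI) (auto simp: incidence_mat_def)
qed

lemma normalized_incidence_mat_basis_vec:
  assumes "distinct xs" "distinct ys" "w \<in> set ys"
  shows "normalized_mat (incidence_mat f xs ys) *\<^sub>v basis_vec ys w =
    vec (length xs) (\<lambda>i. if f (xs ! i) = w
      then 1 / csqrt (of_nat (card {x \<in> set xs. f x = w})) else 0)"
proof (rule eq_vecI)
  fix i
  assume "i < dim_vec (vec (length xs) (\<lambda>i. if f (xs ! i) = w
      then 1 / csqrt (of_nat (card {x \<in> set xs. f x = w})) else (0::complex)))"
  then have i: "i < length xs" by simp
  define c :: complex where "c = 1 / csqrt (of_nat (card {x \<in> set xs. f x = f (xs ! i)}))"
  have "(normalized_mat (incidence_mat f xs ys) *\<^sub>v basis_vec ys w) $ i =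
      (\<Sum>j<length ys. (if ys ! j = f (xs ! i) then c else 0) * (if ys ! j = w then 1 else 0))"
    using i unfolding normalized_incidence_mat[OF assms(1,2)]
    by (simp add: c_def basis_vec_def scalar_prod_def atLeast0LessThan cong: if_cong)
  also have "\<dots> = (\<Sum>y\<in>set ys. (if y = f (xs ! i) then c else 0) * (if y = w then 1 else 0))"
    using assms(2) by (intro sum.reindex_bij_betw bij_betw_nth) auto
  also have "\<dots> = (\<Sum>y\<in>set ys. if y = w then (if w = f (xs ! i) then c else 0) else 0)"
    by (intro sum.cong) auto
  also have "\<dots> = (if f (xs ! i) = w then 1 / csqrt (of_nat (card {x \<in> set xs. f x = w})) else 0)"
    using assms(3) by (auto simp: c_def)
  finally show "(normalized_mat (incidence_mat f xs ys) *\<^sub>v basis_vec ys w) $ i =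
      vec (length xs) (\<lambda>i. if f (xs ! i) = w
        then 1 / csqrt (of_nat (card {x \<in> set xs. f x = w})) else 0) $ i"
    using i by simp
qed (simp add: normalized_incidence_mat[OF assms(1,2)])

text \<open>Two rows of \<open>B\<close> overlap only in the column of a common value of
  \<open>f\<close>, where each entry is the inverse square root of the fibre size. The result is the
  orthogonal projection onto the functions constant on fibres: \<open>Q\<close> for the tail map,
  \<open>P\<close> for \<open>face_of\<close>.\<close>

lemma incidence_projection:
  assumes "distinct xs" "distinct ys" "set ys = f ` set xs"
  defines "B \<equiv> normalized_mat (incidence_mat f xs ys)"
  shows "B * transpose_mat B = mat (length xs) (length xs) (\<lambda>(i, k). if f (xs ! k) = f (xs ! i)
    then 1 / of_nat (card {x \<in> set xs. f x = f (xs ! i)}) else 0)" (is "_ = ?R")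
proof (rule eq_matI)
  fix i k
  assume "i < dim_row ?R" "k < dim_col ?R"
  then have i: "i < length xs" and k: "k < length xs" by simp_all
  define c :: "nat \<Rightarrow> complex"
    where "c m = 1 / csqrt (of_nat (card {x \<in> set xs. f x = f (xs ! m)}))" for m
  have mem: "f (xs ! i) \<in> set ys" using assms(3) i by simp
  have "(B * transpose_mat B) $$ (i, k) = (\<Sum>j<length ys.
      (if ys ! j = f (xs ! i) then c i else 0) * (if ys ! j = f (xs ! k) then c k else 0))"
    using i k unfolding B_def normalized_incidence_mat[OF assms(1,2)]
    by (simp add: c_def scalar_prod_def atLeast0LessThan cong: if_cong)
  also have "\<dots> = (\<Sum>y\<in>set ys.
      (if y = f (xs ! i) then c i else 0) * (if y = f (xs ! k) then c k else 0))"
    using assms(2) by (intro sum.reindex_bij_betw bij_betw_nth) auto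
  also have "\<dots> = (\<Sum>y\<in>set ys.
      if y = f (xs ! i) then c i * (if f (xs ! i) = f (xs ! k) then c k else 0) else 0)"
    by (intro sum.cong) auto
  \<comment> \<open>\<open>c i\<close> and \<open>c k\<close> agree when the fibres coincide, and
    \<open>mem\<close> ensures that the common value has a column.\<close>
  also have "\<dots> = (if f (xs ! k) = f (xs ! i) then c i * c i else 0)"
    using mem by (auto simp: c_def)
  also have "\<dots> = ?R $$ (i, k)"
    using i k unfolding c_def times_divide_times_eq csqrt_mult_self by simp
  finally show "(B * transpose_mat B) $$ (i, k) = ?R $$ (i, k)" .
qed (simp_all add: B_def normalized_incidence_mat[OF assms(1,2)])

lemma incidence_projection_mult_vec:
  assumes "distinct xs" "distinct ys" "set ys = f ` set xs"
  defines "B \<equiv> normalized_mat (incidence_mat f xs ys)"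
  shows "(B * transpose_mat B) *\<^sub>v vec (length xs) (\<lambda>i. g (xs ! i)) =
    vec (length xs) (\<lambda>i. (\<Sum>x | x \<in> set xs \<and> f x = f (xs ! i). g x) /
      of_nat (card {x \<in> set xs. f x = f (xs ! i)}))" (is "_ = ?R")
proof (rule eq_vecI)
  fix i
  assume "i < dim_vec ?R"
  then have i: "i < length xs" by simp
  define c :: complex where "c = of_nat (card {x \<in> set xs. f x = f (xs ! i)})"
  have "((B * transpose_mat B) *\<^sub>v vec (length xs) (\<lambda>i. g (xs ! i))) $ i =
      (\<Sum>k<length xs. (if f (xs ! k) = f (xs ! i) then 1 / c else 0) * g (xs ! k))"
    using i unfolding B_def incidence_projection[OF assms(1-3)]
    by (simp add: c_def scalar_prod_def atLeast0LessThan cong: if_cong)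
  also have "\<dots> = (\<Sum>x\<in>set xs. (if f x = f (xs ! i) then 1 / c else 0) * g x)"
    using assms(1) by (intro sum.reindex_bij_betw bij_betw_nth) auto
  also have "\<dots> = (\<Sum>x\<in>set xs. if f x = f (xs ! i) then g x / c else 0)"
    by (intro sum.cong) auto
  also have "\<dots> = (\<Sum>x | x \<in> set xs \<and> f x = f (xs ! i). g x / c)"
    by (simp add: sum.If_cases Int_def)
  also have "\<dots> = ?R $ i"
    using i by (simp add: c_def sum_divide_distrib)
  finally show "((B * transpose_mat B) *\<^sub>v vec (length xs) (\<lambda>i. g (xs ! i))) $ i = ?R $ i" .
qed (simp_all add: B_def incidence_projection[OF assms(1-3)])

text \<open>One formula serves both factors of the walk, with \<open>f\<close> the tail map or
  \<open>face_of\<close>. Writing the state as a function \<open>g\<close> of arcs reduces each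
  factor to counting arcs in fibres.\<close>

lemma incidence_reflection_mult_vec:
  assumes "distinct xs" "distinct ys" "set ys = f ` set xs"
  defines "B \<equiv> normalized_mat (incidence_mat f xs ys)"
  shows "(2 \<cdot>\<^sub>m (B * transpose_mat B) - 1\<^sub>m (length xs)) *\<^sub>v vec (length xs) (\<lambda>i. g (xs ! i)) =
    vec (length xs) (\<lambda>i. 2 * ((\<Sum>x | x \<in> set xs \<and> f x = f (xs ! i). g x) /
      of_nat (card {x \<in> set xs. f x = f (xs ! i)})) - g (xs ! i))"
proof -
  define v where "v = vec (length xs) (\<lambda>i. g (xs ! i))"
  have v: "v \<in> carrier_vec (length xs)" by (simp add: v_def)
  have C: "B * transpose_mat B \<in> carrier_mat (length xs) (length xs)"
    by (simp add: B_def incidence_projection[OF assms(1-3)])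
  have "(2 \<cdot>\<^sub>m (B * transpose_mat B) - 1\<^sub>m (length xs)) *\<^sub>v v =
      2 \<cdot>\<^sub>v ((B * transpose_mat B) *\<^sub>v v) - v"
    unfolding minus_mult_distrib_mat_vec[OF smult_carrier_mat[OF C] one_carrier_mat v]
      one_mult_mat_vec[OF v]
    using C v by (subst smult_mat_mult_vec) auto
  then show ?thesis
    unfolding v_def B_def incidence_projection_mult_vec[OF assms(1-3)] by auto
qed


section \<open>Facial walks of the dipole maps\<close>

lemma arcs_dipole_map: "arcs (map_graph (dipole_map n)) = {1..n} \<times> UNIV"
  using pole.exhaust by (auto simp: dipole_map_def dipole_graph_def)

lemma verts_dipole_map: "verts (map_graph (dipole_map n)) = UNIV"
  using pole.exhaust by (auto simp: dipole_map_def dipole_graph_def)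

lemma tail_dipole_map: "tail (map_graph (dipole_map n)) = snd"
  by (simp add: dipole_map_def dipole_graph_def)

lemma (in orientable_map) face_step_permutes: "face_step X permutes arcs (map_graph X)"
  unfolding face_step_def
  by (rule permutes_compose[OF arev_permutes_arcs permutes_inv[OF rot_permutes]])

text \<open>The orbit of a permutation is a whole cycle, so it is the same from each of its points;
  finiteness of the arc set makes \<open>face_step\<close> a \<open>permutation\<close>.\<close>

lemma (in orientable_map) face_of_face_step: "face_of X (face_step X a) = face_of X a"
proof -
  have "permutation (face_step X)"
    unfolding permutation_permutes using finite_arcs face_step_permutes by (intro exI conjI)
  then show ?thesis
    unfolding face_of_def by (rule permutation_orbit_step)
qed

lemma snd_rot_dipole:
  assumes "a \<in> arcs (map_graph (dipole_map n))"
  shows "snd (map_rot (dipole_map n) a) = snd a"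
  using assms dipole_rot[of "fst a" n "snd a"] by (auto simp: arcs_dipole_map)

lemma snd_face_step_dipole:
  assumes "n \<ge> 1" "a \<in> arcs (map_graph (dipole_map n))"
  shows "snd (face_step (dipole_map n) a) = other_pole (snd a)"
proof -
  interpret orientable_map "dipole_map n" by (rule orientable_dipole_map[OF assms(1)])
  let ?b = "face_step (dipole_map n) a"
  have "?b \<in> arcs (map_graph (dipole_map n))"
    using face_step_permutes assms(2) by (simp add: permutes_in_image)
  \<comment> \<open>No formula for the inverse rotation is needed: the rotation keeps the tail of
    \<open>?b\<close> and sends \<open>?b\<close> to the reversal of \<open>a\<close>.\<close>
  then have "snd ?b = snd (map_rot (dipole_map n) ?b)" by (simp add: snd_rot_dipole)
  also have "map_rot (dipole_map n) ?b = map_rev (dipole_map n) a"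
    unfolding face_step_def by (simp add: permutes_inverses[OF rot_permutes])
  also have "snd \<dots> = other_pole (snd a)"
    using assms(2) by (cases a; cases "snd a") (auto simp: dipole_map_def dipole_graph_def)
  finally show ?thesis .
qed

text \<open>\<open>face_step\<close> injects the arcs of a face leaving one pole into those leaving
  the other. Using this from both poles gives both inequalities.\<close>

lemma card_face_tail_dipole:
  fixes n F
  assumes "n \<ge> 1"
  defines "S \<equiv> \<lambda>w. {a \<in> arcs (map_graph (dipole_map n)). face_of (dipole_map n) a = F \<and> snd a = w}"
  shows "card (S (other_pole w)) = card (S w)"
proof -
  interpret orientable_map "dipole_map n" by (rule orientable_dipole_map[OF assms(1)])
  let ?f = "face_step (dipole_map n)"
  have fin: "finite (S w)" for w using finite_arcs by (simp add: S_def)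
  have "?f ` S w \<subseteq> S (other_pole w)" for w
    using face_step_permutes
    by (auto simp: S_def face_of_face_step snd_face_step_dipole[OF assms(1)] permutes_in_image)
  moreover have "inj_on ?f (S w)" for w
    using face_step_permutes by (meson permutes_inj inj_on_subset subset_UNIV)
  ultimately have le: "card (S w) \<le> card (S (other_pole w))" for w
    using fin by (metis card_inj_on_le)
  from le[of w] le[of "other_pole w"] show ?thesis by (simp add: other_pole_neq)
qed

text \<open>This factor 2 is what makes the face average of the initial state half of its nonzero
  value.\<close>

lemma card_face_dipole:
  assumes "n \<ge> 1"
  shows "card {a \<in> arcs (map_graph (dipole_map n)). face_of (dipole_map n) a = F} =
    2 * card {a \<in> arcs (map_graph (dipole_map n)). face_of (dipole_map n) a = F \<and> snd a = w}"
proof -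
  define S where
    "S w = {a \<in> arcs (map_graph (dipole_map n)). face_of (dipole_map n) a = F \<and> snd a = w}" for w
  interpret orientable_map "dipole_map n" by (rule orientable_dipole_map[OF assms])
  have fin: "finite (S w)" for w using finite_arcs by (simp add: S_def)
  have "snd a = w \<or> snd a = other_pole w" for a :: "nat \<times> pole"
    by (cases w; cases "snd a") auto
  then have "{a \<in> arcs (map_graph (dipole_map n)). face_of (dipole_map n) a = F} =
      S w \<union> S (other_pole w)"
    by (auto simp: S_def)
  moreover have "S w \<inter> S (other_pole w) = {}" by (auto simp: S_def other_pole_neq)
  moreover have "card (S (other_pole w)) = card (S w)"
    unfolding S_def by (rule card_face_tail_dipole[OF assms])
  ultimately show ?thesis using fin by (simp add: card_Un_disjoint S_def)
qed

lemma card_tail_dipole: "card {a \<in> arcs (map_graph (dipole_map n)). snd a = w} = n"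
proof -
  have "{a \<in> arcs (map_graph (dipole_map n)). snd a = w} = {1..n} \<times> {w}"
    by (auto simp: arcs_dipole_map)
  then show ?thesis by simp
qed

theorem theorem7p1:
  fixes n :: nat
    and as :: "(nat \<times> pole) list" and vs :: "pole list" and fs :: "(nat \<times> pole) set list"
  assumes "n \<ge> 2"
    and "distinct as" and "set as = arcs (map_graph (dipole_map n))"
    and "distinct vs" and "set vs = verts (map_graph (dipole_map n))"
    and "distinct fs" and "set fs = faces (dipole_map n)"
  shows "vertex_face_walk (dipole_map n) as vs fs *\<^sub>v
           (N_hat (dipole_map n) as vs *\<^sub>v basis_vec vs Pole_u) =
         N_hat (dipole_map n) as vs *\<^sub>v basis_vec vs Pole_v"
proof -
  let ?X = "dipole_map n"
  \<comment> \<open>Each pole is the tail of \<open>n\<close> arcs, so \<open>s\<close> is the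
    nonzero entry in the columns of \<open>N_hat\<close>, and \<open>g w\<close> is the state spread
    evenly over the arcs leaving \<open>w\<close>.\<close>
  define s :: complex where "s = 1 / csqrt (of_nat n)"
  define g where "g w a = (if snd a = w then s else 0)" for w and a :: "nat \<times> pole"
  have n: "n \<ge> 1" using assms(1) by simp
  \<comment> \<open>With at least one edge, both poles occur as tails, so \<open>vs\<close> lists
    exactly the values of \<open>snd\<close>, as the averaging formula requires.\<close>
  have vs: "set vs = snd ` set as"
    using n unfolding assms(3,5) arcs_dipole_map verts_dipole_map by force
  have fs: "set fs = face_of ?X ` set as"
    unfolding assms(3,7) faces_def ..
  have state: "N_hat ?X as vs *\<^sub>v basis_vec vs w = vec (length as) (\<lambda>i. g w (as ! i))" for w
    unfolding N_hat_def N_mat_def tail_dipole_map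
    using normalized_incidence_mat_basis_vec[OF assms(2,4), of w snd]
    by (simp add: assms(3,5) verts_dipole_map card_tail_dipole g_def s_def cong: if_cong)
  have Q: "(2 \<cdot>\<^sub>m Q_mat ?X as vs - 1\<^sub>m (length as)) *\<^sub>v vec (length as) (\<lambda>i. g Pole_u (as ! i)) =
      vec (length as) (\<lambda>i. g Pole_u (as ! i))"
  proof -
    \<comment> \<open>\<open>g Pole_u\<close> depends only on the tail, so it is constant on each
      fibre and equals its own average.\<close>
    have avg: "(\<Sum>x | x \<in> set as \<and> snd x = snd a. g Pole_u x) = of_nat n * g Pole_u a" for a
    proof -
      have "(\<Sum>x | x \<in> set as \<and> snd x = snd a. g Pole_u x) =
          (\<Sum>x | x \<in> set as \<and> snd x = snd a. g Pole_u a)"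
        by (intro sum.cong) (auto simp: g_def)
      then show ?thesis by (simp add: assms(3) card_tail_dipole)
    qed
    show ?thesis
      unfolding Q_mat_def N_hat_def N_mat_def tail_dipole_map
        incidence_reflection_mult_vec[OF assms(2,4) vs] avg
      using n by (simp add: assms(3) card_tail_dipole)
  qed
  have P: "(2 \<cdot>\<^sub>m P_mat ?X as fs - 1\<^sub>m (length as)) *\<^sub>v vec (length as) (\<lambda>i. g Pole_u (as ! i)) =
      vec (length as) (\<lambda>i. g Pole_v (as ! i))"
  proof -
    have "2 * ((\<Sum>x | x \<in> set as \<and> face_of ?X x = face_of ?X a. g Pole_u x) /
        of_nat (card {x \<in> set as. face_of ?X x = face_of ?X a})) - g Pole_u a = g Pole_v a"
      if "a \<in> set as" for a
    proof -
      define k where "k = card {x \<in> set as. face_of ?X x = face_of ?X a \<and> snd x = Pole_u}"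
      have card: "card {x \<in> set as. face_of ?X x = face_of ?X a} = 2 * k"
        unfolding k_def assms(3) by (rule card_face_dipole[OF n])
      \<comment> \<open>The face of \<open>a\<close> contains \<open>a\<close>, so \<open>k\<close>
        is nonzero and cancels in the average \<open>k * s / (2 * k)\<close>.\<close>
      have "a \<in> {x \<in> set as. face_of ?X x = face_of ?X a}"
        using that by auto
      then have "card {x \<in> set as. face_of ?X x = face_of ?X a} > 0"
        unfolding card_gt_0_iff by (intro conjI finite_Collect_conjI disjI1) (blast, simp)
      then have "k \<noteq> 0" using card by simp
      have "(\<Sum>x | x \<in> set as \<and> face_of ?X x = face_of ?X a. g Pole_u x) = of_nat k * s"
        unfolding g_def k_def by (simp add: sum.If_cases Int_def)
      \<comment> \<open>What remains is \<open>s - g Pole_u a\<close>: zero on arcs leaving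
        \<open>Pole_u\<close> and \<open>s\<close> on arcs leaving \<open>Pole_v\<close>.\<close>
      then show ?thesis
        unfolding card using \<open>k \<noteq> 0\<close> by (cases "snd a") (simp_all add: g_def)
    qed
    then show ?thesis
      unfolding P_mat_def M_hat_def M_mat_def
        incidence_reflection_mult_vec[OF assms(2,6) fs] by (intro eq_vecI) simp_all
  qed
  have carrier: "2 \<cdot>\<^sub>m P_mat ?X as fs - 1\<^sub>m (length as) \<in> carrier_mat (length as) (length as)"
    "2 \<cdot>\<^sub>m Q_mat ?X as vs - 1\<^sub>m (length as) \<in> carrier_mat (length as) (length as)"
    by (auto intro: minus_carrier_mat)
  \<comment> \<open>By associativity the vertex reflection acts first and fixes the state; the face
    reflection then carries it to the other pole.\<close>
  show ?thesis
    unfolding vertex_face_walk_def state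
      assoc_mult_mat_vec[OF carrier vec_carrier] Q P ..
qed

end
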